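(* Let $Y$ be a univariate response and $X\in\mathbb{R}^p$ a random predictor with mean $\mu=E(X)$ and covariance matrix $\Sigma=\mathrm{Var}(X)$. Let $\tau\in(0,1)$, $\lambda>0$, and $$L_\tau(\alpha,\beta)=\beta^\top\Sigma\beta+\lambda\,E\left[\rho_\tau\{Y-\alpha-\beta^\top(X-\mu)\}\right],\qquad \alpha\in\mathbb{R},\ \beta\in\mathbb{R}^p .$$ Suppose $E(X\mid B^\top X)$ is linear in $B^\top X$, where $B\in\mathbb{R}^{p\times d}$ is a basis of the central space $\mathcal{S}_{Y|X}$. Let $$(\alpha_{0,\tau},\beta_{0,\tau})=\underset{\alpha\in\mathbb{R},\ \beta\in\mathbb{R}^p}{\operatorname{argmin}}\ L_\tau(\alpha,\beta).$$ Then $\beta_{0,\tau}\in\mathcal{S}_{Y|X}$.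
   Context: The asymmetric least squares loss is $\rho_\tau(c)=(1-\tau)c^2$ if $c\le 0$ and $\rho_\tau(c)=\tau c^2$ if $c>0$. A dimension reduction space is the column space of a matrix $B$ such that $Y$ and $X$ are conditionally independent given $B^\top X$. The central space $\mathcal{S}_{Y|X}$ is the intersection of all dimension reduction spaces; it is assumed throughout that this intersection is itself a dimension reduction space. In particular, if the columns of $B\in\mathbb{R}^{p\times d}$ form a basis of $\mathcal{S}_{Y|X}$, then $Y$ and $X$ are conditionally independent given $B^\top X$. "Linear in $B^\top X$" is the usual linear conditional mean condition of the sufficient dimension reduction literature: $E(X\mid B^\top X)=c+MB^\top X$ for some fixed vector $c$ and matrix $M$. The moments appearing in $L_\tau$ are taken to be finite, and the displayed argmin denotes the minimizer, which is presupposed to be well defined. *)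

theory Defs
  imports "HOL-Probability.Probability"
begin

definition als_loss :: "real \<Rightarrow> real \<Rightarrow> real" where
  "als_loss \<tau> c = (if c \<le> 0 then (1 - \<tau>) * c\<^sup>2 else \<tau> * c\<^sup>2)"

definition mean_vec :: "'a measure \<Rightarrow> ('a \<Rightarrow> real ^ 'p) \<Rightarrow> real ^ 'p" where
  "mean_vec M X = (\<integral>\<omega>. X \<omega> \<partial>M)"

definition cov_matrix :: "'a measure \<Rightarrow> ('a \<Rightarrow> real ^ 'p) \<Rightarrow> real ^ 'p ^ 'p" where
  "cov_matrix M X =
     (\<chi> i j. \<integral>\<omega>. (X \<omega> $ i - mean_vec M X $ i) * (X \<omega> $ j - mean_vec M X $ j) \<partial>M)"

definition als_residual ::
    "'a measure \<Rightarrow> ('a \<Rightarrow> real ^ 'p) \<Rightarrow> ('a \<Rightarrow> real) \<Rightarrow> real \<Rightarrow> real ^ 'p \<Rightarrow> 'a \<Rightarrow> real" where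
  "als_residual M X Y \<alpha> \<beta> \<omega> = Y \<omega> - \<alpha> - \<beta> \<bullet> (X \<omega> - mean_vec M X)"

definition als_objective ::
    "'a measure \<Rightarrow> ('a \<Rightarrow> real ^ 'p) \<Rightarrow> ('a \<Rightarrow> real) \<Rightarrow> real \<Rightarrow> real \<Rightarrow> real \<Rightarrow> real ^ 'p \<Rightarrow> real" where
  "als_objective M X Y lam \<tau> \<alpha> \<beta> =
     \<beta> \<bullet> (cov_matrix M X *v \<beta>) + lam * (\<integral>\<omega>. als_loss \<tau> (als_residual M X Y \<alpha> \<beta> \<omega>) \<partial>M)"

text \<open>The number of columns \<open>d\<close> of a matrix \<open>B\<close> has to be quantified over (and may be
  \<open>0\<close>), so a \<open>p \<times> d\<close> matrix is given by \<open>d\<close> together with its columns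
  \<open>B 0, \<dots>, B (d - 1)\<close>; the values \<open>B i\<close> for \<open>i \<ge> d\<close> are irrelevant.\<close>

definition col_space :: "nat \<Rightarrow> (nat \<Rightarrow> real ^ 'p) \<Rightarrow> (real ^ 'p) set" where
  "col_space d B = span (B ` {..<d})"

definition columns_basis :: "nat \<Rightarrow> (nat \<Rightarrow> real ^ 'p) \<Rightarrow> (real ^ 'p) set \<Rightarrow> bool" where
  "columns_basis d B S \<longleftrightarrow>
     inj_on B {..<d} \<and> independent (B ` {..<d}) \<and> col_space d B = S"

text \<open>The vector \<open>B\<^sup>T x\<close>, as an element of the product space over \<open>{..<d}\<close>.\<close>

definition transpose_mult :: "nat \<Rightarrow> (nat \<Rightarrow> real ^ 'p) \<Rightarrow> real ^ 'p \<Rightarrow> nat \<Rightarrow> real" where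
  "transpose_mult d B x = (\<lambda>i\<in>{..<d}. B i \<bullet> x)"

definition reduction_algebra ::
    "'a measure \<Rightarrow> ('a \<Rightarrow> real ^ 'p) \<Rightarrow> nat \<Rightarrow> (nat \<Rightarrow> real ^ 'p) \<Rightarrow> 'a measure" where
  "reduction_algebra M X d B =
     vimage_algebra (space M) (\<lambda>\<omega>. transpose_mult d B (X \<omega>)) (\<Pi>\<^sub>M i\<in>{..<d}. borel)"

definition cond_indep_given ::
    "'a measure \<Rightarrow> 'a measure \<Rightarrow> ('a \<Rightarrow> 'b::topological_space) \<Rightarrow> ('a \<Rightarrow> 'c::topological_space) \<Rightarrow> bool"
  where
  "cond_indep_given M F Y X \<longleftrightarrow>
     (\<forall>A\<in>sets borel. \<forall>C\<in>sets borel. AE \<omega> in M.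
        real_cond_exp M F (\<lambda>\<omega>. indicator A (Y \<omega>) * indicator C (X \<omega>)) \<omega> =
        real_cond_exp M F (\<lambda>\<omega>. indicator A (Y \<omega>)) \<omega> *
        real_cond_exp M F (\<lambda>\<omega>. indicator C (X \<omega>)) \<omega>)"

definition dim_reduction_space ::
    "'a measure \<Rightarrow> ('a \<Rightarrow> real ^ 'p) \<Rightarrow> ('a \<Rightarrow> real) \<Rightarrow> (real ^ 'p) set \<Rightarrow> bool" where
  "dim_reduction_space M X Y S \<longleftrightarrow>
     (\<exists>d B. S = col_space d B \<and> cond_indep_given M (reduction_algebra M X d B) Y X)"

definition central_space ::
    "'a measure \<Rightarrow> ('a \<Rightarrow> real ^ 'p) \<Rightarrow> ('a \<Rightarrow> real) \<Rightarrow> (real ^ 'p) set" where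
  "central_space M X Y = \<Inter> {S. dim_reduction_space M X Y S}"

text \<open>\<open>E(X | B\<^sup>T X) = c + K B\<^sup>T X\<close>, where the vector-valued conditional expectation is taken
  componentwise and the \<open>p \<times> d\<close> matrix \<open>K\<close> is given by its columns.\<close>

definition linear_cond_mean ::
    "'a measure \<Rightarrow> ('a \<Rightarrow> real ^ 'p) \<Rightarrow> nat \<Rightarrow> (nat \<Rightarrow> real ^ 'p) \<Rightarrow> bool" where
  "linear_cond_mean M X d B \<longleftrightarrow>
     (\<exists>c K. \<forall>j. AE \<omega> in M.
        real_cond_exp M (reduction_algebra M X d B) (\<lambda>\<omega>. X \<omega> $ j) \<omega> =
        (c + (\<Sum>i<d. transpose_mult d B (X \<omega>) i *\<^sub>R K i)) $ j)"

end

theory Submission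
  imports Defs
begin

text \<open>
  Replace \<open>Z = \<beta>0 \<bullet> (X - \<mu>)\<close> by its conditional expectation \<open>h\<close> given \<open>B\<^sup>T X\<close>. By linearity of
  \<open>E(X | B\<^sup>T X)\<close>, \<open>h = b \<bullet> (X - \<mu>)\<close> with \<open>b\<close> in the column space of \<open>B\<close>; the additive constant is
  fixed by comparing expectations. Conditioning does not increase the variance, so the quadratic part
  of the objective does not grow. Conditional independence upgrades \<open>E(Z | B\<^sup>T X) = h\<close> to
  \<open>E(Z | Y, h) = h\<close>, so by Jensen's inequality for the convex loss the expected loss does not
  grow either. Hence \<open>(\<alpha>0, b)\<close> is again a minimizer, and uniqueness forces \<open>\<beta>0 = b\<close>.
\<close>

section \<open>Conditional expectation and conditional independence\<close>

lemma (in prob_space) sigma_finite_subalgebraI: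
  assumes "subalgebra M F"
  shows "sigma_finite_subalgebra M F"
proof -
  interpret finite_measure_subalgebra M F
    by unfold_locales (rule assms)
  show ?thesis by unfold_locales
qed

lemma subalgebra_vimage_algebra:
  assumes "f \<in> measurable M N"
  shows "subalgebra M (vimage_algebra (space M) f N)"
  unfolding subalgebra_def using sets_image_in_sets[OF refl assms] by simp

text \<open>Write P for the conditional probability of {Y in A} given \<open>F\<close>. On D = {X in
  C}, the product formula turns E[1_A(Y) 1_C(X)] into E[P E(1_C(X) | F)], which equals E[P 1_C(X)]
  because P is \<open>F\<close>-measurable. As \<open>F\<close> is coarser than the algebra
  generated by \<open>X\<close>, P is also measurable there, so it is the conditional probability
  given \<open>X\<close>.\<close>

lemma (in prob_space) real_cond_exp_vimage_algebra_cond_indep: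
  assumes X[measurable]: "X \<in> borel_measurable M" and Y[measurable]: "Y \<in> borel_measurable M"
    and F: "subalgebra (vimage_algebra (space M) X borel) F"
    and ci: "cond_indep_given M F Y X"
    and A[measurable]: "A \<in> sets borel"
  shows "AE \<omega> in M. real_cond_exp M (vimage_algebra (space M) X borel) (\<lambda>\<omega>. indicator A (Y \<omega>)) \<omega>
           = real_cond_exp M F (\<lambda>\<omega>. indicator A (Y \<omega>)) \<omega>"
proof -
  let ?G = "vimage_algebra (space M) X borel"
  let ?IA = "\<lambda>\<omega>. indicator A (Y \<omega>) :: real"
  let ?P = "real_cond_exp M F ?IA"
  have G: "subalgebra M ?G" by (rule subalgebra_vimage_algebra) simp
  have FM: "subalgebra M F" using F G unfolding subalgebra_def by auto
  interpret G: sigma_finite_subalgebra M ?G by (rule sigma_finite_subalgebraI[OF G])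
  interpret F: sigma_finite_subalgebra M F by (rule sigma_finite_subalgebraI[OF FM])
  have IA: "integrable M ?IA"
    by (rule integrable_const_bound[where B=1]) (auto simp: indicator_def)
  have P: "integrable M ?P" by (rule F.real_cond_exp_int(1)[OF IA])
  show ?thesis
  proof (rule G.real_cond_exp_charact[OF _ IA P])
    show "?P \<in> borel_measurable ?G"
      by (rule measurable_from_subalg[OF F]) simp
    fix D assume "D \<in> sets ?G"
    then obtain C where C[measurable]: "C \<in> sets borel" and D: "D = X -` C \<inter> space M"
      by (auto simp: sets_vimage_algebra2)
    let ?IC = "\<lambda>\<omega>. indicator C (X \<omega>) :: real"
    have IAC: "integrable M (\<lambda>\<omega>. ?IA \<omega> * ?IC \<omega>)"
      by (rule integrable_const_bound[where B=1]) (auto simp: indicator_def)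
    have PC: "integrable M (\<lambda>\<omega>. ?P \<omega> * ?IC \<omega>)"
      by (rule Bochner_Integration.integrable_bound[OF P]) (auto simp: indicator_def)
    have "(\<integral>\<omega>\<in>D. ?IA \<omega> \<partial>M) = (\<integral>\<omega>. ?IA \<omega> * ?IC \<omega> \<partial>M)"
      unfolding set_lebesgue_integral_def D
      by (rule Bochner_Integration.integral_cong) (auto simp: indicator_def)
    also have "\<dots> = (\<integral>\<omega>. real_cond_exp M F (\<lambda>\<omega>. ?IA \<omega> * ?IC \<omega>) \<omega> \<partial>M)"
      by (rule F.real_cond_exp_int(2)[OF IAC, symmetric])
    also have "\<dots> = (\<integral>\<omega>. ?P \<omega> * real_cond_exp M F ?IC \<omega> \<partial>M)"
      by (rule integral_cong_AE) (use ci A C in \<open>auto simp: cond_indep_given_def\<close>)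
    also have "\<dots> = (\<integral>\<omega>. ?P \<omega> * ?IC \<omega> \<partial>M)"
      by (rule F.real_cond_exp_intg(2)[OF PC]) auto
    also have "\<dots> = (\<integral>\<omega>\<in>D. ?P \<omega> \<partial>M)"
      unfolding set_lebesgue_integral_def D
      by (rule Bochner_Integration.integral_cong) (auto simp: indicator_def)
    finally show "(\<integral>\<omega>\<in>D. ?IA \<omega> \<partial>M) = (\<integral>\<omega>\<in>D. ?P \<omega> \<partial>M)" .
  qed
qed

text \<open>A pi-lambda argument: rectangles are stable under intersection and generate the product
  algebra, and the sets over which \<open>Z - h\<close> integrates to zero are closed under
  complements and countable disjoint unions.\<close>

lemma (in prob_space) real_cond_exp_pair_vimage_algebra:
  fixes h U V :: "'a \<Rightarrow> real"
  assumes U[measurable]: "U \<in> borel_measurable M" and V[measurable]: "V \<in> borel_measurable M"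
    and Z: "integrable M Z" and h: "integrable M h"
    and hm: "h \<in> borel_measurable (vimage_algebra (space M) (\<lambda>\<omega>. (U \<omega>, V \<omega>)) (borel \<Otimes>\<^sub>M borel))"
    and rect: "\<And>A C. A \<in> sets borel \<Longrightarrow> C \<in> sets borel \<Longrightarrow>
      (\<integral>\<omega>. indicator A (U \<omega>) * indicator C (V \<omega>) * Z \<omega> \<partial>M) =
      (\<integral>\<omega>. indicator A (U \<omega>) * indicator C (V \<omega>) * h \<omega> \<partial>M)"
  shows "AE \<omega> in M. real_cond_exp M
    (vimage_algebra (space M) (\<lambda>\<omega>. (U \<omega>, V \<omega>)) (borel \<Otimes>\<^sub>M borel)) Z \<omega> = h \<omega>"
proof -
  let ?T = "\<lambda>\<omega>. (U \<omega>, V \<omega>)"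
  let ?N = "borel \<Otimes>\<^sub>M borel :: (real \<times> real) measure"
  let ?G = "vimage_algebra (space M) ?T ?N"
  have T[measurable]: "?T \<in> measurable M ?N" by simp
  interpret G: sigma_finite_subalgebra M ?G
    by (intro sigma_finite_subalgebraI subalgebra_vimage_algebra T)
  have [measurable]: "Z \<in> borel_measurable M" "h \<in> borel_measurable M" using Z h by auto
  define W where "W \<omega> = Z \<omega> - h \<omega>" for \<omega>
  have [measurable]: "W \<in> borel_measurable M" unfolding W_def by simp
  have W: "integrable M W" unfolding W_def using Z h by simp
  have W0: "(\<integral>\<omega>. indicator E (?T \<omega>) * W \<omega> \<partial>M) = 0" if "E \<in> sets ?N" for E
    using Int_stable_pair_measure_generator[of borel borel] pair_measure_closed[of borel borel] that
    unfolding sets_pair_measure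
  proof (induct rule: sigma_sets_induct_disjoint)
    case (basic E)
    then obtain A C where E: "E = A \<times> C" and AC[measurable]: "A \<in> sets borel" "C \<in> sets borel" by auto
    have i: "integrable M (\<lambda>\<omega>. indicator A (U \<omega>) * indicator C (V \<omega>) * Z \<omega>)"
      by (rule Bochner_Integration.integrable_bound[OF Z]) (auto simp: indicator_def)
    have i': "integrable M (\<lambda>\<omega>. indicator A (U \<omega>) * indicator C (V \<omega>) * h \<omega>)"
      by (rule Bochner_Integration.integrable_bound[OF h]) (auto simp: indicator_def)
    have "(\<integral>\<omega>. indicator E (?T \<omega>) * W \<omega> \<partial>M) =
      (\<integral>\<omega>. indicator A (U \<omega>) * indicator C (V \<omega>) * Z \<omega> -
        indicator A (U \<omega>) * indicator C (V \<omega>) * h \<omega> \<partial>M)"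
      by (rule Bochner_Integration.integral_cong) (auto simp: E W_def indicator_def)
    also have "\<dots> = 0" using i i' rect[OF AC] by simp
    finally show ?case .
  next
    case empty
    show ?case by simp
  next
    case (compl E)
    then have [measurable]: "E \<in> sets ?N" by (simp add: sets_pair_measure)
    have i: "integrable M (\<lambda>\<omega>. indicator E (?T \<omega>) * W \<omega>)"
      by (rule Bochner_Integration.integrable_bound[OF W]) (auto simp: indicator_def)
    \<comment> \<open>The full rectangle yields equality of the total expectations, from which the
      integral over a complement is obtained by subtraction.\<close>
    have one: "(\<integral>\<omega>. W \<omega> \<partial>M) = 0"
      using rect[of UNIV UNIV] Z h unfolding W_def by simp
    have "(\<integral>\<omega>. indicator (space borel \<times> space borel - E) (?T \<omega>) * W \<omega> \<partial>M) =
      (\<integral>\<omega>. W \<omega> - indicator E (?T \<omega>) * W \<omega> \<partial>M)"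
      by (rule Bochner_Integration.integral_cong) (auto simp: indicator_def)
    also have "\<dots> = 0" using i W one compl by simp
    finally show ?case .
  next
    case (union E)
    then have [measurable]: "E i \<in> sets ?N" for i by (auto simp: sets_pair_measure)
    let ?D = "\<lambda>i. ?T -` E i \<inter> space M"
    have i: "integrable M (\<lambda>\<omega>. indicator (\<Union>i. ?D i) \<omega> *\<^sub>R W \<omega>)"
      by (rule integrable_mult_indicator[OF _ W]) measurable
    have "(\<integral>\<omega>. indicator (\<Union>i. E i) (?T \<omega>) * W \<omega> \<partial>M) = (LINT \<omega>:(\<Union>i. ?D i)|M. W \<omega>)"
      unfolding set_lebesgue_integral_def
      by (rule Bochner_Integration.integral_cong) (auto simp: indicator_def)
    \<comment> \<open>Countable additivity over the disjoint preimages; integrability of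
      \<open>W\<close> on their union justifies it.\<close>
    also have "\<dots> = (\<Sum>i. (LINT \<omega>:?D i|M. W \<omega>))"
      using union(1) i by (intro lebesgue_integral_countable_add)
        (auto simp: set_integrable_def disjoint_family_on_def)
    also have "\<dots> = (\<Sum>i. (\<integral>\<omega>. indicator (E i) (?T \<omega>) * W \<omega> \<partial>M))"
      unfolding set_lebesgue_integral_def
      by (intro suminf_cong Bochner_Integration.integral_cong) (auto simp: indicator_def)
    also have "\<dots> = 0" using union by simp
    finally show ?case .
  qed
  show ?thesis
  proof (rule G.real_cond_exp_charact[OF _ Z h hm])
    fix D assume "D \<in> sets ?G"
    then obtain E where E[measurable]: "E \<in> sets ?N" and D: "D = ?T -` E \<inter> space M"
      by (auto simp: sets_vimage_algebra2 space_pair_measure)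
    have [measurable]: "D \<in> sets M" unfolding D by measurable
    have "(\<integral>\<omega>\<in>D. Z \<omega> \<partial>M) - (\<integral>\<omega>\<in>D. h \<omega> \<partial>M) = (\<integral>\<omega>\<in>D. W \<omega> \<partial>M)"
      unfolding set_lebesgue_integral_def W_def
      using integrable_mult_indicator[of D M Z] integrable_mult_indicator[of D M h] Z h
      by (simp add: right_diff_distrib)
    also have "\<dots> = (\<integral>\<omega>. indicator E (?T \<omega>) * W \<omega> \<partial>M)"
      unfolding set_lebesgue_integral_def D
      by (rule Bochner_Integration.integral_cong) (auto simp: indicator_def)
    finally show "(\<integral>\<omega>\<in>D. Z \<omega> \<partial>M) = (\<integral>\<omega>\<in>D. h \<omega> \<partial>M)" using W0[OF E] by simp
  qed
qed

text \<open>Since \<open>P(Y \<in> A | X) = P(Y \<in> A | F)\<close>, testing \<open>Z\<close> against \<open>{Y \<in> A} \<inter> {h \<in> C}\<close> amounts to testing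
  it against an \<open>F\<close>-measurable function.\<close>

lemma (in prob_space) real_cond_exp_cond_indep:
  fixes Y h :: "'a \<Rightarrow> real"
  assumes X[measurable]: "X \<in> borel_measurable M" and Y[measurable]: "Y \<in> borel_measurable M"
    and F: "subalgebra (vimage_algebra (space M) X borel) F"
    and ci: "cond_indep_given M F Y X"
    and Z: "integrable M Z" "Z \<in> borel_measurable (vimage_algebra (space M) X borel)"
    and h: "h \<in> borel_measurable F" "AE \<omega> in M. real_cond_exp M F Z \<omega> = h \<omega>"
  shows "AE \<omega> in M. real_cond_exp M
    (vimage_algebra (space M) (\<lambda>\<omega>. (Y \<omega>, h \<omega>)) (borel \<Otimes>\<^sub>M borel)) Z \<omega> = h \<omega>"
proof -
  let ?G = "vimage_algebra (space M) X borel"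
  have G: "subalgebra M ?G" by (rule subalgebra_vimage_algebra) simp
  have FM: "subalgebra M F" using F G unfolding subalgebra_def by auto
  interpret G: sigma_finite_subalgebra M ?G by (rule sigma_finite_subalgebraI[OF G])
  interpret F: sigma_finite_subalgebra M F by (rule sigma_finite_subalgebraI[OF FM])
  have [measurable]: "Z \<in> borel_measurable M" using Z by auto
  have hM[measurable]: "h \<in> borel_measurable M" by (rule measurable_from_subalg[OF FM h(1)])
  have hi: "integrable M h"
    using F.real_cond_exp_int(1)[OF Z(1)]
    by (rule integrable_cong_AE_imp) (use h(2) in auto)
  show ?thesis
  proof (rule real_cond_exp_pair_vimage_algebra[OF Y hM Z(1) hi])
    let ?T = "\<lambda>\<omega>. (Y \<omega>, h \<omega>)"
    have "?T \<in> measurable (vimage_algebra (space M) ?T (borel \<Otimes>\<^sub>M borel)) (borel \<Otimes>\<^sub>M borel)"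
      by (rule measurable_vimage_algebra1) (simp add: space_pair_measure)
    from measurable_compose[OF this measurable_snd]
    show "h \<in> borel_measurable (vimage_algebra (space M) ?T (borel \<Otimes>\<^sub>M borel))" by simp
    fix A C :: "real set" assume [measurable]: "A \<in> sets borel" "C \<in> sets borel"
    let ?IA = "\<lambda>\<omega>. indicator A (Y \<omega>) :: real"
    let ?IC = "\<lambda>\<omega>. indicator C (h \<omega>) :: real"
    let ?P = "real_cond_exp M F ?IA"
    have ICF: "?IC \<in> borel_measurable F" using h(1) by measurable
    have ICG: "?IC \<in> borel_measurable ?G" by (rule measurable_from_subalg[OF F ICF])
    have IA: "integrable M ?IA"
      by (rule integrable_const_bound[where B=1]) (auto simp: indicator_def)
    have PG: "AE \<omega> in M. real_cond_exp M ?G ?IA \<omega> = ?P \<omega>"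
      by (rule real_cond_exp_vimage_algebra_cond_indep[OF X Y F ci]) simp
    have swapZ: "integrable M (\<lambda>\<omega>. ?IC \<omega> * Z \<omega> * ?IA \<omega>)"
      by (rule Bochner_Integration.integrable_bound[OF Z(1)]) (auto simp: indicator_def)
    have swaph: "integrable M (\<lambda>\<omega>. ?IC \<omega> * h \<omega> * ?IA \<omega>)"
      by (rule Bochner_Integration.integrable_bound[OF hi]) (auto simp: indicator_def)
    have ICZG: "(\<lambda>\<omega>. ?IC \<omega> * Z \<omega>) \<in> borel_measurable ?G" using ICG Z(2) by measurable
    have IChF: "(\<lambda>\<omega>. ?IC \<omega> * h \<omega>) \<in> borel_measurable F" using ICF h(1) by measurable
    have IPF: "(\<lambda>\<omega>. ?IC \<omega> * ?P \<omega>) \<in> borel_measurable F" using ICF by measurable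
    \<comment> \<open>No bound on \<open>?P\<close> is at hand, so integrability is inherited from
      the product with the conditional expectation given \<open>?G\<close>, which agrees with
      \<open>?P\<close> almost everywhere.\<close>
    have CP: "integrable M (\<lambda>\<omega>. ?IC \<omega> * ?P \<omega> * Z \<omega>)"
      using G.real_cond_exp_intg(1)[OF swapZ ICZG]
      by (rule integrable_cong_AE_imp) (use PG in auto)
    have "(\<integral>\<omega>. ?IA \<omega> * ?IC \<omega> * Z \<omega> \<partial>M) = (\<integral>\<omega>. (?IC \<omega> * Z \<omega>) * ?IA \<omega> \<partial>M)"
      by (rule Bochner_Integration.integral_cong) auto
    \<comment> \<open>Both \<open>?IC\<close> and \<open>Z\<close> are \<open>?G\<close>-measurable,
      so only the indicator of {Y in A} gets conditioned; conditional independence then replaces the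
      result by \<open>?P\<close>.\<close>
    also have "\<dots> = (\<integral>\<omega>. (?IC \<omega> * Z \<omega>) * real_cond_exp M ?G ?IA \<omega> \<partial>M)"
      by (rule G.real_cond_exp_intg(2)[OF swapZ ICZG, symmetric]) simp
    also have "\<dots> = (\<integral>\<omega>. (?IC \<omega> * ?P \<omega>) * Z \<omega> \<partial>M)"
      by (rule integral_cong_AE) (use PG in auto)
    \<comment> \<open>Now the roles swap: the weight on \<open>Z\<close> is
      \<open>F\<close>-measurable, so \<open>Z\<close> may be replaced by \<open>h\<close>, after
      which the conditioning inside \<open>?P\<close> is undone.\<close>
    also have "\<dots> = (\<integral>\<omega>. (?IC \<omega> * ?P \<omega>) * real_cond_exp M F Z \<omega> \<partial>M)"
      by (rule F.real_cond_exp_intg(2)[OF CP IPF, symmetric]) simp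
    also have "\<dots> = (\<integral>\<omega>. (?IC \<omega> * h \<omega>) * ?P \<omega> \<partial>M)"
      by (rule integral_cong_AE) (use h(2) in auto)
    also have "\<dots> = (\<integral>\<omega>. (?IC \<omega> * h \<omega>) * ?IA \<omega> \<partial>M)"
      by (rule F.real_cond_exp_intg(2)[OF swaph IChF]) simp
    also have "\<dots> = (\<integral>\<omega>. ?IA \<omega> * ?IC \<omega> * h \<omega> \<partial>M)"
      by (rule Bochner_Integration.integral_cong) auto
    finally show "(\<integral>\<omega>. ?IA \<omega> * ?IC \<omega> * Z \<omega> \<partial>M) = (\<integral>\<omega>. ?IA \<omega> * ?IC \<omega> * h \<omega> \<partial>M)" .
  qed
qed

section \<open>The reduction algebra\<close>

lemma transpose_mult_measurable:
  assumes "\<And>i. i < d \<Longrightarrow> (\<lambda>\<omega>. B i \<bullet> X \<omega>) \<in> borel_measurable N"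
  shows "(\<lambda>\<omega>. transpose_mult d B (X \<omega>)) \<in> measurable N (\<Pi>\<^sub>M i\<in>{..<d}. borel)"
  unfolding transpose_mult_def by (rule measurable_restrict) (use assms in auto)

text \<open>Such a linear form is a linear combination of the coordinates of
  \<open>transpose_mult d B (X \<omega>)\<close>, whence induction over the span.\<close>

lemma inner_measurable_reduction_algebra:
  assumes "v \<in> col_space d B"
  shows "(\<lambda>\<omega>. v \<bullet> X \<omega>) \<in> borel_measurable (reduction_algebra M X d B)"
  using assms unfolding col_space_def
proof (induction rule: span_induct_alt)
  case base
  show ?case by simp
next
  case (step c x y)
  then obtain i where i: "i < d" "x = B i" by auto
  have "(\<lambda>\<omega>. transpose_mult d B (X \<omega>)) \<in>
      measurable (reduction_algebra M X d B) (\<Pi>\<^sub>M i\<in>{..<d}. borel)"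
    unfolding reduction_algebra_def
    by (rule measurable_vimage_algebra1) (auto simp: space_PiM transpose_mult_def)
  from measurable_compose[OF this measurable_component_singleton[of i]] i
  have [measurable]: "(\<lambda>\<omega>. x \<bullet> X \<omega>) \<in> borel_measurable (reduction_algebra M X d B)"
    by (simp add: transpose_mult_def)
  note step.IH[measurable]
  show ?case by (simp add: inner_add_left)
qed

lemma space_reduction_algebra: "space (reduction_algebra M X d B) = space M"
  by (simp add: reduction_algebra_def)

text \<open>The ambient algebra \<open>N\<close> is kept apart from \<open>M\<close> so that the
  reduction algebra can be placed both inside \<open>M\<close> and inside the algebra generated by
  \<open>X\<close>.\<close>

lemma subalgebra_reduction_algebra:
  assumes "X \<in> borel_measurable N" "space N = space M"
  shows "subalgebra N (reduction_algebra M X d B)"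
  unfolding reduction_algebra_def assms(2)[symmetric]
  by (intro subalgebra_vimage_algebra transpose_mult_measurable borel_measurable_inner
      borel_measurable_const assms(1))

text \<open>Each column of one matrix lies in the column space of the other, so each algebra makes
  the generators of the other measurable. This carries conditional independence from one spanning
  matrix of the central space to another.\<close>

lemma reduction_algebra_cong:
  assumes "col_space d B = col_space d' B'"
  shows "reduction_algebra M X d B = reduction_algebra M X d' B'"
proof (rule measure_eqI)
  have sub: "sets (reduction_algebra M X d B) \<subseteq> sets (reduction_algebra M X d' B')"
    if "col_space d B = col_space d' B'" for d d' B B'
  proof -
    have "B i \<in> col_space d' B'" if "i < d" for i
      using that \<open>col_space d B = col_space d' B'\<close> by (auto simp: col_space_def intro: span_base)
    then show ?thesis
      unfolding reduction_algebra_def[of M X d B]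
      by (intro sets_image_in_sets transpose_mult_measurable inner_measurable_reduction_algebra)
        (auto simp: space_reduction_algebra)
  qed
  show "sets (reduction_algebra M X d B) = sets (reduction_algebra M X d' B')"
    using sub[OF assms] sub[OF assms[symmetric]] by auto
  \<comment> \<open>\<open>vimage_algebra\<close> is built with \<open>sigma\<close>, which carries
    the zero measure, so the measures agree trivially.\<close>
  show "emeasure (reduction_algebra M X d B) A = emeasure (reduction_algebra M X d' B') A" for A
    by (simp add: reduction_algebra_def vimage_algebra_def emeasure_sigma)
qed

lemma inner_cond_mean_reduction_algebra:
  assumes "prob_space M" and Xi: "integrable M X"
    and lin: "linear_cond_mean M X d B"
  obtains b where "b \<in> col_space d B"
    and "AE \<omega> in M. real_cond_exp M (reduction_algebra M X d B)
      (\<lambda>\<omega>. \<beta> \<bullet> (X \<omega> - mean_vec M X)) \<omega> = b \<bullet> (X \<omega> - mean_vec M X)"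
proof -
  interpret prob_space M by fact
  let ?F = "reduction_algebra M X d B" and ?\<mu> = "mean_vec M X"
  have [measurable]: "X \<in> borel_measurable M" using Xi by auto
  interpret F: sigma_finite_subalgebra M ?F
    by (intro sigma_finite_subalgebraI subalgebra_reduction_algebra) auto
  from lin obtain c K where lin: "\<And>j. AE \<omega> in M. real_cond_exp M ?F (\<lambda>\<omega>. X \<omega> $ j) \<omega> =
      (c + (\<Sum>i<d. transpose_mult d B (X \<omega>) i *\<^sub>R K i)) $ j"
    unfolding linear_cond_mean_def by blast
  \<comment> \<open>In matrix terms this is \<open>B K\<^sup>T \<beta>\<close>, the vector for which
    \<open>\<beta> \<bullet> (K B\<^sup>T x) = b \<bullet> x\<close>.\<close>
  define b where "b = (\<Sum>i<d. (\<beta> \<bullet> K i) *\<^sub>R B i)"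
  have Xj: "integrable M (\<lambda>\<omega>. X \<omega> $ j)" for j
    using integrable_inner_left[where c="axis j 1", OF Xi] by (simp add: inner_axis)
  have Z: "integrable M (\<lambda>\<omega>. \<beta> \<bullet> (X \<omega> - ?\<mu>))" using Xi by simp
  have bX: "integrable M (\<lambda>\<omega>. b \<bullet> X \<omega>)" using Xi by simp
  have eq: "AE \<omega> in M. real_cond_exp M ?F (\<lambda>\<omega>. \<beta> \<bullet> (X \<omega> - ?\<mu>)) \<omega> = \<beta> \<bullet> (c - ?\<mu>) + b \<bullet> X \<omega>"
  proof -
    have 1: "AE \<omega> in M. real_cond_exp M ?F (\<lambda>\<omega>. \<beta> \<bullet> X \<omega> - \<beta> \<bullet> ?\<mu>) \<omega> =
        real_cond_exp M ?F (\<lambda>\<omega>. \<beta> \<bullet> X \<omega>) \<omega> - real_cond_exp M ?F (\<lambda>\<omega>. \<beta> \<bullet> ?\<mu>) \<omega>"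
      using Xi by (intro F.real_cond_exp_diff) auto
    have 2: "AE \<omega> in M. real_cond_exp M ?F (\<lambda>\<omega>. \<beta> \<bullet> ?\<mu>) \<omega> = \<beta> \<bullet> ?\<mu>"
      by (intro F.real_cond_exp_F_meas) auto
    have 3: "AE \<omega> in M. real_cond_exp M ?F (\<lambda>\<omega>. \<Sum>j\<in>UNIV. \<beta> $ j * X \<omega> $ j) \<omega> =
        (\<Sum>j\<in>UNIV. real_cond_exp M ?F (\<lambda>\<omega>. \<beta> $ j * X \<omega> $ j) \<omega>)"
      using Xj by (intro F.real_cond_exp_sum) auto
    have 4: "AE \<omega> in M. \<forall>j. real_cond_exp M ?F (\<lambda>\<omega>. \<beta> $ j * X \<omega> $ j) \<omega> =
        \<beta> $ j * real_cond_exp M ?F (\<lambda>\<omega>. X \<omega> $ j) \<omega>"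
      unfolding AE_all_countable using Xj by (intro allI F.real_cond_exp_cmult)
    have 5: "AE \<omega> in M. \<forall>j. real_cond_exp M ?F (\<lambda>\<omega>. X \<omega> $ j) \<omega> =
      (c + (\<Sum>i<d. transpose_mult d B (X \<omega>) i *\<^sub>R K i)) $ j"
      unfolding AE_all_countable using lin by blast
    from 1 2 3 4 5 show ?thesis
    proof eventually_elim
      case (elim \<omega>)
      have "real_cond_exp M ?F (\<lambda>\<omega>. \<beta> \<bullet> X \<omega>) \<omega> =
          \<beta> \<bullet> (c + (\<Sum>i<d. transpose_mult d B (X \<omega>) i *\<^sub>R K i))"
        using elim(3-5) by (simp add: inner_vec_def)
      also have "\<dots> = \<beta> \<bullet> c + b \<bullet> X \<omega>"
        unfolding b_def by (simp add: inner_add_right inner_sum_right inner_sum_left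
            transpose_mult_def mult.commute)
      finally show ?case using elim(1,2) by (simp add: inner_diff_right)
    qed
  qed
  have mean: "(\<integral>\<omega>. v \<bullet> X \<omega> \<partial>M) = v \<bullet> ?\<mu>" for v
    unfolding mean_vec_def using Xi by (cases "v = 0") auto
  \<comment> \<open>Conditioning preserves expectation and the left side is zero, which forces the
    additive constant to be \<open>- (b \<bullet> ?\<mu>)\<close>.\<close>
  have "(\<integral>\<omega>. \<beta> \<bullet> (X \<omega> - ?\<mu>) \<partial>M) = (\<integral>\<omega>. \<beta> \<bullet> (c - ?\<mu>) + b \<bullet> X \<omega> \<partial>M)"
    unfolding F.real_cond_exp_int(2)[OF Z, symmetric]
    by (rule integral_cong_AE) (use eq in auto)
  then have "\<beta> \<bullet> (c - ?\<mu>) + b \<bullet> ?\<mu> = 0"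
    using Xi mean by (simp add: inner_diff_right prob_space)
  then have "AE \<omega> in M. real_cond_exp M ?F (\<lambda>\<omega>. \<beta> \<bullet> (X \<omega> - ?\<mu>)) \<omega> = b \<bullet> (X \<omega> - ?\<mu>)"
    using eq by (auto simp: inner_diff_right)
  moreover have "b \<in> col_space d B"
    unfolding b_def col_space_def by (intro span_sum span_scale span_base) auto
  ultimately show ?thesis using that by blast
qed

section \<open>Square-integrable functions and the loss\<close>

lemma integrable_mult_L2:
  fixes f g :: "'a \<Rightarrow> real"
  assumes [measurable]: "f \<in> borel_measurable M" "g \<in> borel_measurable M"
    and "integrable M (\<lambda>x. (f x)\<^sup>2)" "integrable M (\<lambda>x. (g x)\<^sup>2)"
  shows "integrable M (\<lambda>x. f x * g x)"
proof (rule Bochner_Integration.integrable_bound)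
  show "integrable M (\<lambda>x. (f x)\<^sup>2 + (g x)\<^sup>2)" using assms by simp
  have "\<bar>a * b\<bar> \<le> a\<^sup>2 + b\<^sup>2" for a b :: real
    using sum_squares_bound[of "\<bar>a\<bar>" "\<bar>b\<bar>"] mult_nonneg_nonneg[of "\<bar>a\<bar>" "\<bar>b\<bar>"]
    unfolding abs_mult power2_abs mult.assoc by linarith
  then show "AE x in M. norm (f x * g x) \<le> norm ((f x)\<^sup>2 + (g x)\<^sup>2)" by simp
qed simp

lemma (in finite_measure) integrable_L2:
  fixes f :: "'a \<Rightarrow> 'b::{banach, second_countable_topology}"
  assumes [measurable]: "f \<in> borel_measurable M" and "integrable M (\<lambda>x. (norm (f x))\<^sup>2)"
  shows "integrable M f"
proof (rule Bochner_Integration.integrable_bound)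
  show "integrable M (\<lambda>x. 1 + (norm (f x))\<^sup>2)" using assms by simp
  have "a \<le> 1 + a\<^sup>2" if "0 \<le> a" for a :: real
    using sum_squares_bound[of a 1] that by simp
  then show "AE x in M. norm (f x) \<le> norm (1 + (norm (f x))\<^sup>2)" by simp
qed simp

text \<open>Pulling out the \<open>F\<close>-measurable \<open>h\<close> gives E(hZ) = E(h^2); then
  integrate 2hZ - h^2 \<le> Z^2.\<close>

lemma (in prob_space) integral_square_real_cond_exp_le:
  fixes Z h :: "'a \<Rightarrow> real"
  assumes F: "subalgebra M F"
    and Zm[measurable]: "Z \<in> borel_measurable M" and Z: "integrable M (\<lambda>\<omega>. (Z \<omega>)\<^sup>2)"
    and hF: "h \<in> borel_measurable F" and h: "integrable M (\<lambda>\<omega>. (h \<omega>)\<^sup>2)"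
    and ce: "AE \<omega> in M. real_cond_exp M F Z \<omega> = h \<omega>"
  shows "(\<integral>\<omega>. (h \<omega>)\<^sup>2 \<partial>M) \<le> (\<integral>\<omega>. (Z \<omega>)\<^sup>2 \<partial>M)"
proof -
  interpret F: sigma_finite_subalgebra M F by (rule sigma_finite_subalgebraI[OF F])
  have [measurable]: "h \<in> borel_measurable M" by (rule measurable_from_subalg[OF F hF])
  have hZ: "integrable M (\<lambda>\<omega>. h \<omega> * Z \<omega>)" by (rule integrable_mult_L2) (use Z h in auto)
  have "(\<integral>\<omega>. h \<omega> * Z \<omega> \<partial>M) = (\<integral>\<omega>. h \<omega> * real_cond_exp M F Z \<omega> \<partial>M)"
    by (rule F.real_cond_exp_intg(2)[OF hZ hF, symmetric]) simp
  also have "\<dots> = (\<integral>\<omega>. (h \<omega>)\<^sup>2 \<partial>M)"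
    by (rule integral_cong_AE) (use ce in \<open>auto simp: power2_eq_square\<close>)
  finally have eq: "(\<integral>\<omega>. h \<omega> * Z \<omega> \<partial>M) = (\<integral>\<omega>. (h \<omega>)\<^sup>2 \<partial>M)" .
  have "(\<integral>\<omega>. 2 * (h \<omega> * Z \<omega>) - (h \<omega>)\<^sup>2 \<partial>M) \<le> (\<integral>\<omega>. (Z \<omega>)\<^sup>2 \<partial>M)"
  proof (rule integral_mono)
    show "2 * (h \<omega> * Z \<omega>) - (h \<omega>)\<^sup>2 \<le> (Z \<omega>)\<^sup>2" for \<omega>
      using sum_squares_bound[of "h \<omega>" "Z \<omega>"] by simp
  qed (use hZ h Z in auto)
  then show ?thesis using hZ h eq by simp
qed

text \<open>Expand the square into a double sum over coordinates. Taking \<open>v\<close> to be an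
  axis vector in \<open>sq\<close> gives the second moments that make each product of coordinates
  integrable.\<close>

lemma cov_matrix_quadratic_form:
  assumes [measurable]: "X \<in> borel_measurable M"
    and sq: "\<And>v. integrable M (\<lambda>\<omega>. (v \<bullet> (X \<omega> - mean_vec M X))\<^sup>2)"
  shows "\<beta> \<bullet> (cov_matrix M X *v \<beta>) = (\<integral>\<omega>. (\<beta> \<bullet> (X \<omega> - mean_vec M X))\<^sup>2 \<partial>M)"
proof -
  define W where "W \<omega> = X \<omega> - mean_vec M X" for \<omega>
  have [measurable]: "W \<in> borel_measurable M" unfolding W_def by simp
  have [measurable]: "(\<lambda>\<omega>. W \<omega> $ i) \<in> borel_measurable M" for i
    using borel_measurable_inner[of W M "\<lambda>_. axis i 1"] by (simp add: inner_axis)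
  have Wsq: "integrable M (\<lambda>\<omega>. (W \<omega> $ i)\<^sup>2)" for i
    using sq[of "axis i 1"] by (simp add: W_def inner_axis')
  have ij: "integrable M (\<lambda>\<omega>. W \<omega> $ i * W \<omega> $ j)" for i j
    by (rule integrable_mult_L2) (use Wsq in auto)
  have "(\<integral>\<omega>. (\<beta> \<bullet> W \<omega>)\<^sup>2 \<partial>M) = (\<integral>\<omega>. (\<Sum>i\<in>UNIV. \<Sum>j\<in>UNIV. \<beta> $ i * \<beta> $ j * (W \<omega> $ i * W \<omega> $ j)) \<partial>M)"
    by (rule Bochner_Integration.integral_cong)
      (auto simp: inner_vec_def power2_eq_square sum_product ac_simps intro!: sum.cong)
  also have "\<dots> = (\<Sum>i\<in>UNIV. \<Sum>j\<in>UNIV. \<beta> $ i * \<beta> $ j * (\<integral>\<omega>. W \<omega> $ i * W \<omega> $ j \<partial>M))"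
    using ij by simp
  also have "\<dots> = \<beta> \<bullet> (cov_matrix M X *v \<beta>)"
    by (simp add: inner_vec_def matrix_vector_mult_def cov_matrix_def W_def sum_distrib_left ac_simps)
  finally show ?thesis by (simp add: W_def)
qed

section \<open>Convexity of the asymmetric squared loss and a conditional Jensen inequality\<close>

definition als_weight :: "real \<Rightarrow> real \<Rightarrow> real" where
  "als_weight \<tau> c = (if c \<le> 0 then 1 - \<tau> else \<tau>)"

lemma als_loss_weight: "als_loss \<tau> c = als_weight \<tau> c * c\<^sup>2"
  by (simp add: als_loss_def als_weight_def)

text \<open>\<open>2 * als_weight \<tau> x * x\<close> is the derivative of the loss at \<open>x\<close>.\<close>

lemma als_loss_convex:
  assumes "0 \<le> \<tau>" "\<tau> \<le> 1"
  shows "als_loss \<tau> x + 2 * als_weight \<tau> x * x * (y - x) \<le> als_loss \<tau> y"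
proof -
  let ?w = "als_weight \<tau>"
  have w: "0 \<le> ?w z" for z using assms by (simp add: als_weight_def)
  \<comment> \<open>With equal weights the gap in the inequality is
    \<open>?w y * (y - x)\<^sup>2\<close>. Otherwise \<open>x\<close> and \<open>y\<close> lie on
    different sides of zero, and the gap is
    \<open>?w y * y\<^sup>2 + ?w x * x\<^sup>2 - 2 * ?w x * (x * y)\<close>, a sum of nonnegative
    terms.\<close>
  consider "?w x = ?w y" | "x * y \<le> 0"
    by (cases "x \<le> 0"; cases "y \<le> 0") (auto simp: als_weight_def mult_le_0_iff)
  then show ?thesis
  proof cases
    case 1
    have "0 \<le> ?w y * (y - x)\<^sup>2" using w by simp
    then show ?thesis unfolding als_loss_weight 1
      by (simp add: power2_eq_square algebra_simps)
  next
    case 2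
    have "?w x * (x * y) \<le> 0" using w 2 by (simp add: mult_nonneg_nonpos)
    moreover have "0 \<le> ?w x * x\<^sup>2" "0 \<le> ?w y * y\<^sup>2" using w by simp_all
    ultimately show ?thesis unfolding als_loss_weight
      by (simp add: power2_eq_square algebra_simps)
  qed
qed

text \<open>Conditional Jensen by way of the tangent line of the loss at \<open>R - h\<close>. Its
  slope is \<open>G\<close>-measurable, because \<open>R\<close> and \<open>h\<close> are, so the
  linear term has expectation zero.\<close>

lemma (in prob_space) integral_als_loss_real_cond_exp_le:
  fixes R Z h :: "'a \<Rightarrow> real"
  assumes "0 < \<tau>" "\<tau> < 1" and G: "subalgebra M G"
    and Zm[measurable]: "Z \<in> borel_measurable M" and Z: "integrable M (\<lambda>\<omega>. (Z \<omega>)\<^sup>2)"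
    and hG: "h \<in> borel_measurable G" and h: "integrable M (\<lambda>\<omega>. (h \<omega>)\<^sup>2)"
    and RG: "R \<in> borel_measurable G"
    and RZ: "integrable M (\<lambda>\<omega>. als_loss \<tau> (R \<omega> - Z \<omega>))"
    and Rh: "integrable M (\<lambda>\<omega>. als_loss \<tau> (R \<omega> - h \<omega>))"
    and ce: "AE \<omega> in M. real_cond_exp M G Z \<omega> = h \<omega>"
  shows "(\<integral>\<omega>. als_loss \<tau> (R \<omega> - h \<omega>) \<partial>M) \<le> (\<integral>\<omega>. als_loss \<tau> (R \<omega> - Z \<omega>) \<partial>M)"
proof -
  interpret G: sigma_finite_subalgebra M G by (rule sigma_finite_subalgebraI[OF G])
  have [measurable]: "h \<in> borel_measurable M" "R \<in> borel_measurable M"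
    by (rule measurable_from_subalg[OF G], fact)+
  define \<psi> where "\<psi> \<omega> = als_weight \<tau> (R \<omega> - h \<omega>) * (R \<omega> - h \<omega>)" for \<omega>
  have \<psi>G: "\<psi> \<in> borel_measurable G"
    unfolding \<psi>_def als_weight_def using hG RG by measurable
  then have \<psi>M[measurable]: "\<psi> \<in> borel_measurable M" by (rule measurable_from_subalg[OF G])
  have \<psi>sq: "integrable M (\<lambda>\<omega>. (\<psi> \<omega>)\<^sup>2)"
  proof (rule Bochner_Integration.integrable_bound[OF Rh])
    \<comment> \<open>The weight lies between 0 and 1 and so dominates its square. Finiteness of the
      expected loss thus makes \<open>\<psi>\<close> square integrable, and its products with
      \<open>Z\<close> and \<open>h\<close> integrable.\<close>
    have "(als_weight \<tau> c * c)\<^sup>2 \<le> als_loss \<tau> c" for c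
    proof -
      have "als_weight \<tau> c * als_weight \<tau> c \<le> als_weight \<tau> c * 1"
        using assms(1,2) by (intro mult_left_mono) (auto simp: als_weight_def)
      then show ?thesis
        unfolding als_loss_weight power_mult_distrib
        by (intro mult_right_mono) (auto simp: power2_eq_square)
    qed
    moreover have "0 \<le> als_loss \<tau> c" for c using assms(1,2) by (simp add: als_loss_def)
    ultimately show "AE \<omega> in M. norm ((\<psi> \<omega>)\<^sup>2) \<le> norm (als_loss \<tau> (R \<omega> - h \<omega>))"
      by (simp add: \<psi>_def)
  qed simp
  have \<psi>Z: "integrable M (\<lambda>\<omega>. \<psi> \<omega> * Z \<omega>)" by (rule integrable_mult_L2) (use \<psi>sq Z in auto)
  have \<psi>h: "integrable M (\<lambda>\<omega>. \<psi> \<omega> * h \<omega>)" by (rule integrable_mult_L2) (use \<psi>sq h in auto)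
  have "(\<integral>\<omega>. \<psi> \<omega> * Z \<omega> \<partial>M) = (\<integral>\<omega>. \<psi> \<omega> * real_cond_exp M G Z \<omega> \<partial>M)"
    by (rule G.real_cond_exp_intg(2)[OF \<psi>Z \<psi>G, symmetric]) simp
  also have "\<dots> = (\<integral>\<omega>. \<psi> \<omega> * h \<omega> \<partial>M)"
    by (rule integral_cong_AE) (use ce in auto)
  finally have eq: "(\<integral>\<omega>. \<psi> \<omega> * Z \<omega> \<partial>M) = (\<integral>\<omega>. \<psi> \<omega> * h \<omega> \<partial>M)" .
  have "(\<integral>\<omega>. als_loss \<tau> (R \<omega> - h \<omega>) + 2 * (\<psi> \<omega> * h \<omega> - \<psi> \<omega> * Z \<omega>) \<partial>M)
      \<le> (\<integral>\<omega>. als_loss \<tau> (R \<omega> - Z \<omega>) \<partial>M)"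
  proof (rule integral_mono)
    show "als_loss \<tau> (R \<omega> - h \<omega>) + 2 * (\<psi> \<omega> * h \<omega> - \<psi> \<omega> * Z \<omega>) \<le> als_loss \<tau> (R \<omega> - Z \<omega>)" for \<omega>
      using als_loss_convex[of \<tau> "R \<omega> - h \<omega>" "R \<omega> - Z \<omega>"] assms(1,2)
      by (simp add: \<psi>_def algebra_simps)
  qed (use Rh RZ \<psi>h \<psi>Z in auto)
  then show ?thesis using Rh \<psi>h \<psi>Z eq by simp
qed

section \<open>Replacing the minimizing direction by one in the central space\<close>

theorem theorem1:
  fixes M :: "'a measure"
    and X :: "'a \<Rightarrow> real ^ 'p"
    and Y :: "'a \<Rightarrow> real"
    and \<tau> lam \<alpha>0 :: real
    and \<beta>0 :: "real ^ 'p"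
    and d :: nat
    and B :: "nat \<Rightarrow> real ^ 'p"
  assumes "prob_space M"
    and "X \<in> borel_measurable M"
    and "Y \<in> borel_measurable M"
    and "0 < \<tau>" and "\<tau> < 1" and "0 < lam"
    and "integrable M (\<lambda>\<omega>. (norm (X \<omega>))\<^sup>2)"
    and "\<And>\<alpha> \<beta>. integrable M (\<lambda>\<omega>. als_loss \<tau> (als_residual M X Y \<alpha> \<beta> \<omega>))"
    and "dim_reduction_space M X Y (central_space M X Y)"
    and "columns_basis d B (central_space M X Y)"
    and "linear_cond_mean M X d B"
    and "\<exists>!\<theta>. is_arg_min (\<lambda>(\<alpha>, \<beta>). als_objective M X Y lam \<tau> \<alpha> \<beta>) (\<lambda>_. True) \<theta>"
    and "(\<alpha>0, \<beta>0) = arg_min (\<lambda>(\<alpha>, \<beta>). als_objective M X Y lam \<tau> \<alpha> \<beta>) (\<lambda>_. True)"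
  shows "\<beta>0 \<in> central_space M X Y"
proof -
  interpret prob_space M by fact
  note [measurable] = \<open>X \<in> borel_measurable M\<close> \<open>Y \<in> borel_measurable M\<close>
  let ?\<mu> = "mean_vec M X" and ?F = "reduction_algebra M X d B"
  let ?G = "vimage_algebra (space M) X borel"
  have S: "col_space d B = central_space M X Y"
    using \<open>columns_basis d B _\<close> by (simp add: columns_basis_def)
  \<comment> \<open>The definition provides some spanning matrix, not the given basis
    \<open>B\<close>; equality of column spaces transfers the conditional independence.\<close>
  obtain d' B' where "central_space M X Y = col_space d' B'"
    "cond_indep_given M (reduction_algebra M X d' B') Y X"
    using \<open>dim_reduction_space M X Y _\<close> unfolding dim_reduction_space_def by blast
  then have ci: "cond_indep_given M ?F Y X"
    using reduction_algebra_cong[of d B d' B' M X] S by simp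
  have XG: "X \<in> borel_measurable ?G" by (rule measurable_vimage_algebra1) simp
  have FG: "subalgebra ?G ?F" by (rule subalgebra_reduction_algebra[OF XG]) simp
  have FM: "subalgebra M ?F" by (rule subalgebra_reduction_algebra) simp_all
  have Xi: "integrable M X" by (rule integrable_L2) (use assms in auto)
  obtain b where b: "b \<in> col_space d B"
    and ce: "AE \<omega> in M. real_cond_exp M ?F (\<lambda>\<omega>. \<beta>0 \<bullet> (X \<omega> - ?\<mu>)) \<omega> = b \<bullet> (X \<omega> - ?\<mu>)"
    by (rule inner_cond_mean_reduction_algebra[OF \<open>prob_space M\<close> Xi \<open>linear_cond_mean M X d B\<close>])
  define Z where "Z \<omega> = \<beta>0 \<bullet> (X \<omega> - ?\<mu>)" for \<omega>
  define h where "h \<omega> = b \<bullet> (X \<omega> - ?\<mu>)" for \<omega>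
  have ce: "AE \<omega> in M. real_cond_exp M ?F Z \<omega> = h \<omega>" using ce by (simp add: Z_def[abs_def] h_def)
  have [measurable]: "Z \<in> borel_measurable M" "h \<in> borel_measurable M"
    unfolding Z_def h_def by auto
  \<comment> \<open>Cauchy-Schwarz bounds every centered linear form by the norm of
    \<open>X\<close>, whose square is integrable.\<close>
  have sq: "integrable M (\<lambda>\<omega>. (v \<bullet> (X \<omega> - ?\<mu>))\<^sup>2)" for v
  proof (rule Bochner_Integration.integrable_bound)
    show "integrable M (\<lambda>\<omega>. (norm v)\<^sup>2 * (2 * (norm (X \<omega>))\<^sup>2 + 2 * (norm ?\<mu>)\<^sup>2))"
      using \<open>integrable M (\<lambda>\<omega>. (norm (X \<omega>))\<^sup>2)\<close> by simp
    have "(v \<bullet> (x - ?\<mu>))\<^sup>2 \<le> (norm v)\<^sup>2 * (2 * (norm x)\<^sup>2 + 2 * (norm ?\<mu>)\<^sup>2)" for x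
    proof -
      have "(v \<bullet> (x - ?\<mu>))\<^sup>2 \<le> (norm v)\<^sup>2 * (norm (x - ?\<mu>))\<^sup>2"
        using Cauchy_Schwarz_ineq[of v "x - ?\<mu>"] by (simp add: power2_norm_eq_inner)
      also have "(norm (x - ?\<mu>))\<^sup>2 \<le> (norm x + norm ?\<mu>)\<^sup>2"
        by (intro power_mono norm_triangle_ineq4) simp
      also have "\<dots> \<le> 2 * (norm x)\<^sup>2 + 2 * (norm ?\<mu>)\<^sup>2"
        using sum_squares_bound[of "norm x" "norm ?\<mu>"] by (simp add: power2_sum)
      finally show ?thesis by (simp add: mult_left_mono)
    qed
    then show "AE \<omega> in M. norm ((v \<bullet> (X \<omega> - ?\<mu>))\<^sup>2) \<le>
        norm ((norm v)\<^sup>2 * (2 * (norm (X \<omega>))\<^sup>2 + 2 * (norm ?\<mu>)\<^sup>2))"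
      by simp
  qed simp
  have Zsq: "integrable M (\<lambda>\<omega>. (Z \<omega>)\<^sup>2)" and hsq: "integrable M (\<lambda>\<omega>. (h \<omega>)\<^sup>2)"
    unfolding Z_def h_def by (rule sq)+
  have hF: "h \<in> borel_measurable ?F"
    using inner_measurable_reduction_algebra[OF b, of X M, measurable]
    unfolding h_def inner_diff_right by measurable
  have var: "b \<bullet> (cov_matrix M X *v b) \<le> \<beta>0 \<bullet> (cov_matrix M X *v \<beta>0)"
    using integral_square_real_cond_exp_le[OF FM _ Zsq hF hsq ce]
    by (simp add: cov_matrix_quadratic_form[OF _ sq] Z_def h_def)
  let ?T = "\<lambda>\<omega>. (Y \<omega>, h \<omega>)"
  let ?H = "vimage_algebra (space M) ?T (borel \<Otimes>\<^sub>M borel)"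
  have T: "?T \<in> measurable ?H (borel \<Otimes>\<^sub>M borel)"
    by (rule measurable_vimage_algebra1) (simp add: space_pair_measure)
  have YH: "Y \<in> borel_measurable ?H" using measurable_compose[OF T measurable_fst] by simp
  have hH: "h \<in> borel_measurable ?H" using measurable_compose[OF T measurable_snd] by simp
  have ZG: "Z \<in> borel_measurable ?G" unfolding Z_def using XG by measurable
  have ceH: "AE \<omega> in M. real_cond_exp M ?H Z \<omega> = h \<omega>"
    by (rule real_cond_exp_cond_indep[OF _ _ FG ci _ ZG hF ce])
      (use Xi in \<open>auto simp: Z_def[abs_def]\<close>)
  have "(\<integral>\<omega>. als_loss \<tau> (Y \<omega> - \<alpha>0 - h \<omega>) \<partial>M) \<le> (\<integral>\<omega>. als_loss \<tau> (Y \<omega> - \<alpha>0 - Z \<omega>) \<partial>M)"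
  proof (rule integral_als_loss_real_cond_exp_le[OF \<open>0 < \<tau>\<close> \<open>\<tau> < 1\<close> _ _ Zsq hH hsq _ _ _ ceH])
    show "subalgebra M ?H" by (rule subalgebra_vimage_algebra) simp
    show "(\<lambda>\<omega>. Y \<omega> - \<alpha>0) \<in> borel_measurable ?H" using YH by measurable
    show "integrable M (\<lambda>\<omega>. als_loss \<tau> (Y \<omega> - \<alpha>0 - Z \<omega>))"
      using assms(8)[of \<alpha>0 \<beta>0] by (simp add: als_residual_def Z_def)
    show "integrable M (\<lambda>\<omega>. als_loss \<tau> (Y \<omega> - \<alpha>0 - h \<omega>))"
      using assms(8)[of \<alpha>0 b] by (simp add: als_residual_def h_def)
  qed simp
  then have le: "als_objective M X Y lam \<tau> \<alpha>0 b \<le> als_objective M X Y lam \<tau> \<alpha>0 \<beta>0"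
    unfolding als_objective_def als_residual_def Z_def[symmetric] h_def[symmetric]
    using var \<open>0 < lam\<close> by (intro add_mono mult_left_mono) auto
  let ?L = "\<lambda>(\<alpha>, \<beta>). als_objective M X Y lam \<tau> \<alpha> \<beta>"
  \<comment> \<open>\<open>arg_min\<close> is a Hilbert choice, so existence of a minimizer is what
    guarantees that the chosen pair is one.\<close>
  have min: "is_arg_min ?L (\<lambda>_. True) (\<alpha>0, \<beta>0)"
    unfolding assms(13) arg_min_def using assms(12) by (metis (no_types, lifting) someI)
  then have "is_arg_min ?L (\<lambda>_. True) (\<alpha>0, b)"
    using le unfolding is_arg_min_linorder by (auto intro: order_trans)
  \<comment> \<open>Uniqueness of the minimizing pair is applied to two pairs with the same
    intercept \<open>\<alpha>0\<close>.\<close>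
  then have "b = \<beta>0" using min assms(12) by blast
  then show ?thesis using b S by simp
qed

end
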